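(* For integers $m\ge0$ put $T_m:=\frac1{m!}\left(\frac{\pi^2}{8}\right)^m$ and $Z_m:=\frac{\zeta(2)^m}{m!}$. Let $0<u<1$ and let $N\ge0$ be an integer. For every integer $m\ge0$, $$\left|\sum_{r>N}\frac{\binom{4r}{2r}}{16^r(4r+1)}t_{2r}(\{2\}^m)u^r\right|\le\frac{T_m}{4\sqrt{2\pi}}\,\frac{u^{N+1}}{(N+1)^{3/2}(1-u)},$$ $$\left|\sum_{r>N}\frac{\binom{4r+2}{2r+1}}{2^{4r+2}(4r+3)}t_{2r+1}(\{2\}^m)u^r\right|\le\frac{T_m}{\sqrt\pi}\,\frac{u^{N+1}}{(N+1)^{3/2}(1-u)}.$$ For every integer $m\ge1$, $$\left|\sum_{r>N}\frac{16^ru^r}{r^2\binom{4r}{2r}}\zeta_{2r-1}(\{2\}^{m-1})\right|\le2\sqrt2\,Z_{m-1}\,\frac{u^{N+1}}{(N+1)^{3/2}(1-u)},$$ $$\left|\sum_{r>N}\frac{4^{2r+1}u^r}{(2r+1)^2\binom{4r+2}{2r+1}}\zeta_{2r}(\{2\}^{m-1})\right|\le2Z_{m-1}\,\frac{u^{N+1}}{(N+1)^{3/2}(1-u)}.$$ At the endpoint $u=1$, the corresponding tails are $O_m((N+1)^{-1/2})$. More explicitly, let $C_m$ be the constant $\frac{T_m}{4\sqrt{2\pi}}$, $\frac{T_m}{\sqrt\pi}$, $2\sqrt2\,Z_{m-1}$, $2Z_{m-1}$ in the first, second, third, fourth case respectively. Then in each case the tail $\sum_{r>N}$ with $u=1$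 is bounded in absolute value by $3C_m(N+1)^{-1/2}$ for all $N\ge0$, and by $2C_mN^{-1/2}$ for all $N\ge1$.
   Context: For integers $n\ge0$, $m\ge0$, the finite repeated-$2$ sums are $$\zeta_n(\{2\}^m):=\sum_{n\ge n_1>\cdots>n_m\ge1}\frac1{n_1^2\cdots n_m^2},\qquad t_n(\{2\}^m):=\sum_{n\ge n_1>\cdots>n_m\ge1}\frac1{(2n_1-1)^2\cdots(2n_m-1)^2},$$ with the value $1$ when $m=0$ and the value $0$ when $m>n$. $\zeta(2)=\pi^2/6$ is the Riemann zeta value. *)

theory Defs
  imports "HOL-Analysis.Analysis" "HOL-Library.Landau_Symbols"
begin

(* The index tuples (n_1, ..., n_m) with n >= n_1 > ... > n_m >= 1. *)
definition dec_chains :: "nat \<Rightarrow> nat \<Rightarrow> nat list set" where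
  "dec_chains n m = {ks. length ks = m \<and> sorted_wrt (>) ks \<and> set ks \<subseteq> {1..n}}"

definition zeta_fin :: "nat \<Rightarrow> nat \<Rightarrow> real" where
  "zeta_fin n m = (\<Sum>ks\<in>dec_chains n m. \<Prod>k\<leftarrow>ks. 1 / (real k)\<^sup>2)"

definition t_fin :: "nat \<Rightarrow> nat \<Rightarrow> real" where
  "t_fin n m = (\<Sum>ks\<in>dec_chains n m. \<Prod>k\<leftarrow>ks. 1 / (2 * real k - 1)\<^sup>2)"

lemma finite_dec_chains: "finite (dec_chains n m)"
  by (rule finite_subset[OF _ finite_lists_length_eq[of "{1..n}" m]])
     (auto simp: dec_chains_def)

lemma dec_chains_0: "dec_chains n 0 = {[]}"
  by (auto simp: dec_chains_def)

lemma dec_chains_empty: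
  assumes "m > n"
  shows "dec_chains n m = {}"
proof (rule ccontr)
  assume "dec_chains n m \<noteq> {}"
  then obtain ks where ks: "length ks = m" "sorted_wrt (>) ks" "set ks \<subseteq> {1..n}"
    by (auto simp: dec_chains_def)
  have "distinct ks"
    using ks(2) by (induction ks) auto
  then have "m = card (set ks)"
    using ks(1) by (simp add: distinct_card)
  also have "\<dots> \<le> card {1..n}"
    using ks(3) by (intro card_mono) auto
  finally show False
    using assms by simp
qed

lemma zeta_fin_0: "zeta_fin n 0 = 1" and t_fin_0: "t_fin n 0 = 1"
  by (simp_all add: zeta_fin_def t_fin_def dec_chains_0)

lemma zeta_fin_eq_0: "m > n \<Longrightarrow> zeta_fin n m = 0"
  and t_fin_eq_0: "m > n \<Longrightarrow> t_fin n m = 0"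
  by (simp_all add: zeta_fin_def t_fin_def dec_chains_empty)

definition zeta2 :: real where
  "zeta2 = (\<Sum>n. 1 / (real (Suc n))\<^sup>2)"

lemma zeta2_eq: "zeta2 = pi\<^sup>2 / 6"
  using inverse_squares_sums by (simp add: zeta2_def sums_iff add.commute)

definition T_const :: "nat \<Rightarrow> real" where
  "T_const m = (pi\<^sup>2 / 8) ^ m / fact m"

definition Z_const :: "nat \<Rightarrow> real" where
  "Z_const m = zeta2 ^ m / fact m"

definition t_even_summand :: "nat \<Rightarrow> real \<Rightarrow> nat \<Rightarrow> real" where
  "t_even_summand m u r =
     real ((4 * r) choose (2 * r)) / (16 ^ r * real (4 * r + 1)) * t_fin (2 * r) m * u ^ r"

definition t_odd_summand :: "nat \<Rightarrow> real \<Rightarrow> nat \<Rightarrow> real" where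
  "t_odd_summand m u r =
     real ((4 * r + 2) choose (2 * r + 1)) / (2 ^ (4 * r + 2) * real (4 * r + 3))
       * t_fin (2 * r + 1) m * u ^ r"

(* The two zeta summands are used only for m >= 1 and r >= 1,
   where the natural-number subtractions do not truncate. *)
definition zeta_even_summand :: "nat \<Rightarrow> real \<Rightarrow> nat \<Rightarrow> real" where
  "zeta_even_summand m u r =
     16 ^ r * u ^ r / ((real r)\<^sup>2 * real ((4 * r) choose (2 * r))) * zeta_fin (2 * r - 1) (m - 1)"

definition zeta_odd_summand :: "nat \<Rightarrow> real \<Rightarrow> nat \<Rightarrow> real" where
  "zeta_odd_summand m u r =
     4 ^ (2 * r + 1) * u ^ r / ((real (2 * r + 1))\<^sup>2 * real ((4 * r + 2) choose (2 * r + 1)))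
       * zeta_fin (2 * r) (m - 1)"

end

theory Submission
  imports Defs "HOL-Real_Asymp.Real_Asymp"
begin

text \<open>All summands are nonnegative. The elementary symmetric sums are at most \<open>p\<^sup>m / m!\<close> for the
  corresponding power sum \<open>p\<close>, and \<open>n (binom(2n, n) / 4\<^sup>n)\<^sup>2\<close> increases from \<open>1/4\<close> to \<open>1/\<pi>\<close> (Wallis),
  so each coefficient is at most \<open>C\<^sub>m r\<^sup>-\<^sup>3\<^sup>/\<^sup>2\<close>. The tails are then compared with
  telescoping sums.\<close>

subsection \<open>Elementary symmetric sums\<close>

text \<open>Entries decrease along a chain, so \<open>Suc n\<close> can occur only at its head. The
  chains split according to whether it does.\<close>

lemma dec_chains_Suc:
  "dec_chains (Suc n) (Suc m) = dec_chains n (Suc m) \<union> Cons (Suc n) ` dec_chains n m"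
proof (intro equalityI subsetI)
  fix ks assume ks: "ks \<in> dec_chains (Suc n) (Suc m)"
  then obtain k ls where [simp]: "ks = k # ls"
    by (cases ks) (auto simp: dec_chains_def)
  from ks have *: "length ls = m" "sorted_wrt (>) ls" "\<forall>l\<in>set ls. l < k"
      "1 \<le> k" "k \<le> Suc n" "\<forall>l\<in>set ls. 1 \<le> l"
    by (auto simp: dec_chains_def)
  show "ks \<in> dec_chains n (Suc m) \<union> Cons (Suc n) ` dec_chains n m"
  proof (cases "k = Suc n")
    case True
    with * have "ls \<in> dec_chains n m" by (fastforce simp: dec_chains_def)
    with True show ?thesis by auto
  next
    case False
    with * have "ks \<in> dec_chains n (Suc m)" by (fastforce simp: dec_chains_def)
    then show ?thesis by auto
  qed
next
  fix ks assume "ks \<in> dec_chains n (Suc m) \<union> Cons (Suc n) ` dec_chains n m"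
  then show "ks \<in> dec_chains (Suc n) (Suc m)"
    by (fastforce simp: dec_chains_def)
qed

text \<open>The Pascal-type recurrence of the elementary symmetric polynomials, which drives the
  induction on \<open>n\<close> in \<open>sum_dec_chains_le\<close>.\<close>

lemma sum_dec_chains_Suc:
  fixes x :: "nat \<Rightarrow> real"
  shows "(\<Sum>ks\<in>dec_chains (Suc n) (Suc m). \<Prod>k\<leftarrow>ks. x k)
    = (\<Sum>ks\<in>dec_chains n (Suc m). \<Prod>k\<leftarrow>ks. x k)
      + x (Suc n) * (\<Sum>ks\<in>dec_chains n m. \<Prod>k\<leftarrow>ks. x k)"
proof -
  have "dec_chains n (Suc m) \<inter> Cons (Suc n) ` dec_chains n m = {}"
    by (auto simp: dec_chains_def)
  then have "(\<Sum>ks\<in>dec_chains (Suc n) (Suc m). \<Prod>k\<leftarrow>ks. x k)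
      = (\<Sum>ks\<in>dec_chains n (Suc m). \<Prod>k\<leftarrow>ks. x k)
        + (\<Sum>ks\<in>Cons (Suc n) ` dec_chains n m. \<Prod>k\<leftarrow>ks. x k)"
    unfolding dec_chains_Suc by (intro sum.union_disjoint) (auto simp: finite_dec_chains)
  then show ?thesis
    by (simp add: sum.reindex sum_distrib_left)
qed

text \<open>The first two terms of the binomial expansion; all later ones are nonnegative.\<close>

lemma power_Suc_add_ge:
  fixes a b :: real
  assumes "0 \<le> a" "0 \<le> b"
  shows "a ^ Suc m + real (Suc m) * b * a ^ m \<le> (a + b) ^ Suc m"
proof (induction m)
  case (Suc m)
  \<comment> \<open>The right side exceeds the left by exactly
    \<open>real (Suc m) * b\<^sup>2 * a ^ m\<close>.\<close>
  have "a ^ Suc (Suc m) + real (Suc (Suc m)) * b * a ^ Suc m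
      \<le> (a + b) * (a ^ Suc m + real (Suc m) * b * a ^ m)"
    using assms by (simp add: algebra_simps)
  also have "\<dots> \<le> (a + b) * (a + b) ^ Suc m"
    using assms by (intro mult_left_mono Suc.IH) auto
  finally show ?case by simp
qed simp

text \<open>When the power of the sum is multiplied out, the product along each chain arises
  \<open>fact m\<close> times, once per ordering, and the other terms are nonnegative. The proof
  obtains this by induction on \<open>n\<close>.\<close>

lemma sum_dec_chains_le:
  fixes x :: "nat \<Rightarrow> real"
  assumes nonneg: "\<And>k. 0 \<le> x k"
  shows "(\<Sum>ks\<in>dec_chains n m. \<Prod>k\<leftarrow>ks. x k) \<le> (\<Sum>k=1..n. x k) ^ m / fact m"
proof (induction n arbitrary: m)
  case 0
  show ?case by (cases m) (simp_all add: dec_chains_0 dec_chains_empty)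
next
  case (Suc n)
  show ?case
  proof (cases m)
    case 0
    then show ?thesis by (simp add: dec_chains_0)
  next
    case m: (Suc l)
    define S where "S = (\<Sum>k=1..n. x k)"
    have S: "0 \<le> S" by (simp add: S_def sum_nonneg nonneg)
    have "(\<Sum>ks\<in>dec_chains (Suc n) m. \<Prod>k\<leftarrow>ks. x k)
        \<le> S ^ Suc l / fact (Suc l) + x (Suc n) * (S ^ l / fact l)"
      unfolding m sum_dec_chains_Suc S_def
      by (intro add_mono mult_left_mono Suc.IH nonneg)
    also have "\<dots> = (S ^ Suc l + real (Suc l) * x (Suc n) * S ^ l) / fact (Suc l)"
    proof -
      have "(1::real) + real l \<noteq> 0" by linarith
      then show ?thesis by (simp add: add_divide_distrib)
    qed
    also have "\<dots> \<le> (S + x (Suc n)) ^ Suc l / fact (Suc l)"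
      by (intro divide_right_mono power_Suc_add_ge S nonneg) simp
    finally show ?thesis by (simp add: m S_def)
  qed
qed

lemma sum_dec_chains_nonneg:
  fixes x :: "nat \<Rightarrow> real"
  assumes "\<And>k. 0 \<le> x k"
  shows "0 \<le> (\<Sum>ks\<in>dec_chains n m. \<Prod>k\<leftarrow>ks. x k)"
  using assms by (intro sum_nonneg prod_list_nonneg) auto

lemma sum_inverse_squares_tendsto: "(\<lambda>n. \<Sum>k=1..n. 1 / (real k)\<^sup>2) \<longlonglongrightarrow> pi\<^sup>2 / 6"
proof -
  have "(\<lambda>n. \<Sum>k<n. 1 / (real (Suc k))\<^sup>2) \<longlonglongrightarrow> pi\<^sup>2 / 6"
    using inverse_squares_sums by (simp add: sums_def add.commute)
  then show ?thesis
    by (simp add: sum.atLeast1_atMost_eq)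
qed

lemma sum_inverse_squares_le: "(\<Sum>k=1..n. 1 / (real k)\<^sup>2) \<le> pi\<^sup>2 / 6"
  by (rule incseq_le[OF _ sum_inverse_squares_tendsto]) (auto intro: incseq_SucI)

text \<open>The even terms among the first \<open>2 * n\<close> inverse squares are a quarter of the
  first \<open>n\<close> inverse squares; removing them leaves the odd ones. In the limit this turns
  \<open>pi\<^sup>2 / 6\<close> into \<open>pi\<^sup>2 / 8\<close>.\<close>

lemma sum_odd_inverse_squares_eq:
  "(\<Sum>k=1..n. 1 / (2 * real k - 1)\<^sup>2)
    = (\<Sum>k=1..2 * n. 1 / (real k)\<^sup>2) - (\<Sum>k=1..n. 1 / (real k)\<^sup>2) / 4"
proof (induction n)
  case (Suc n)
  have "1 / (2 * real (Suc n))\<^sup>2 = 1 / (real (Suc n))\<^sup>2 / 4"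
    by (simp only: power_mult_distrib) simp
  then have even: "(\<Sum>k=1..2 * Suc n. 1 / (real k)\<^sup>2)
      = (\<Sum>k=1..2 * n. 1 / (real k)\<^sup>2) + 1 / (2 * real n + 1)\<^sup>2 + 1 / (real (Suc n))\<^sup>2 / 4"
    by (simp add: add.commute)
  show ?case
    unfolding even using Suc by (simp add: add_divide_distrib)
qed simp

lemma sum_odd_inverse_squares_le: "(\<Sum>k=1..n. 1 / (2 * real k - 1)\<^sup>2) \<le> pi\<^sup>2 / 8"
proof (rule incseq_le)
  show "incseq (\<lambda>n. \<Sum>k=1..n. 1 / (2 * real k - 1)\<^sup>2)"
    by (rule incseq_SucI) simp
  have "strict_mono (\<lambda>n::nat. 2 * n)" by (auto intro: strict_monoI)
  from LIMSEQ_subseq_LIMSEQ[OF sum_inverse_squares_tendsto this]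
  have "(\<lambda>n. (\<Sum>k=1..2 * n. 1 / (real k)\<^sup>2) - (\<Sum>k=1..n. 1 / (real k)\<^sup>2) / 4)
      \<longlonglongrightarrow> pi\<^sup>2 / 6 - pi\<^sup>2 / 6 / 4"
    by (intro tendsto_intros sum_inverse_squares_tendsto) (simp_all add: o_def)
  then show "(\<lambda>n. \<Sum>k=1..n. 1 / (2 * real k - 1)\<^sup>2) \<longlonglongrightarrow> pi\<^sup>2 / 8"
    unfolding sum_odd_inverse_squares_eq by simp
qed

lemma t_fin_nonneg: "0 \<le> t_fin n m"
  unfolding t_fin_def by (rule sum_dec_chains_nonneg) simp

lemma zeta_fin_nonneg: "0 \<le> zeta_fin n m"
  unfolding zeta_fin_def by (rule sum_dec_chains_nonneg) simp

lemma t_fin_le: "t_fin n m \<le> T_const m"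
proof -
  have "t_fin n m \<le> (\<Sum>k=1..n. 1 / (2 * real k - 1)\<^sup>2) ^ m / fact m"
    unfolding t_fin_def by (rule sum_dec_chains_le) simp
  also have "\<dots> \<le> T_const m"
    unfolding T_const_def
    by (intro divide_right_mono power_mono sum_odd_inverse_squares_le sum_nonneg) auto
  finally show ?thesis .
qed

lemma zeta_fin_le: "zeta_fin n m \<le> Z_const m"
proof -
  have "zeta_fin n m \<le> (\<Sum>k=1..n. 1 / (real k)\<^sup>2) ^ m / fact m"
    unfolding zeta_fin_def by (rule sum_dec_chains_le) simp
  also have "\<dots> \<le> Z_const m"
    unfolding Z_const_def zeta2_eq
    by (intro divide_right_mono power_mono sum_inverse_squares_le sum_nonneg) auto
  finally show ?thesis .
qed

subsection \<open>Central binomial coefficients\<close>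

text \<open>Equals the Wallis-type product of (2k-1)/(2k) over 1 \<le> k \<le> n. Each of the four
  summands contains this ratio or its reciprocal, at index 2r or 2r+1.\<close>

definition central_ratio :: "nat \<Rightarrow> real" where
  "central_ratio n = real ((2 * n) choose n) / 4 ^ n"

lemma central_ratio_0 [simp]: "central_ratio 0 = 1"
  by (simp add: central_ratio_def)

lemma central_ratio_pos: "0 < central_ratio n"
  by (simp add: central_ratio_def)

lemma central_ratio_Suc:
  "central_ratio (Suc n) = central_ratio n * (2 * real n + 1) / (2 * real n + 2)"
proof -
  have central: "real ((2 * k) choose k) = fact (2 * k) / (fact k)\<^sup>2" for k
    using binomial_fact[of k "2 * k", where ?'a = real] by (simp add: power2_eq_square)
  have f2: "(fact (2 * Suc n) :: real) = 2 * (real n + 1) * (2 * real n + 1) * fact (2 * n)"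
    by (simp add: algebra_simps)
  have f1: "(fact (Suc n) :: real) = (real n + 1) * fact n"
    by (simp add: algebra_simps)
  \<comment> \<open>\<open>F\<close> and \<open>f\<close> stand for the factorials of 2n and n, and
    \<open>a\<close> for n+1, so that one factor n+1 cancels.\<close>
  have cancel: "2 * a * b * F / (a * f)\<^sup>2 = F / f\<^sup>2 * (2 * b) / a" if "a \<noteq> 0" for a b F f :: real
    using that by (simp add: field_simps power2_eq_square)
  have "real ((2 * Suc n) choose Suc n)
      = 2 * (real n + 1) * (2 * real n + 1) * fact (2 * n) / ((real n + 1) * fact n)\<^sup>2"
    by (simp only: central f2 f1)
  also have "\<dots> = real ((2 * n) choose n) * (2 * (2 * real n + 1)) / (real n + 1)"
    unfolding central by (rule cancel) linarith
  finally have "central_ratio (Suc n)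
      = real ((2 * n) choose n) * (2 * (2 * real n + 1)) / (real n + 1) / 4 ^ Suc n"
    unfolding central_ratio_def by (rule arg_cong)
  also have "\<dots> = central_ratio n * (2 * real n + 1) / (2 * (real n + 1))"
    by (simp only: central_ratio_def power_Suc) (simp add: divide_simps, simp add: algebra_simps)
  finally show ?thesis by (simp add: algebra_simps)
qed

text \<open>For n \<ge> 1 the quotient of consecutive terms is (2n+1)^2 / (4n(n+1)), which exceeds 1
  because (2n+1)^2 = 4n(n+1) + 1.\<close>

lemma incseq_mult_central_ratio: "incseq (\<lambda>n. real n * (central_ratio n)\<^sup>2)"
proof (rule incseq_SucI)
  fix n
  have "real (Suc n) * (central_ratio (Suc n))\<^sup>2
      = (central_ratio n)\<^sup>2 * ((2 * real n + 1)\<^sup>2 / (4 * (real n + 1)))"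
  proof -
    have "(real n + 1) \<noteq> 0" "2 * real n + 2 \<noteq> 0" by linarith+
    then show ?thesis
      by (simp add: central_ratio_Suc power2_eq_square divide_simps) (simp add: algebra_simps)
  qed
  moreover have "real n \<le> (2 * real n + 1)\<^sup>2 / (4 * (real n + 1))"
    by (simp add: power2_eq_square field_simps)
  ultimately show "real n * (central_ratio n)\<^sup>2 \<le> real (Suc n) * (central_ratio (Suc n))\<^sup>2"
    by (metis mult.commute mult_left_mono zero_le_power2)
qed

text \<open>Each factor is (2k/(2k-1))^2 times (2k-1)/(2k+1). The squares multiply to the inverse
  square of the central ratio, and the remaining fractions telescope to 1/(2n+1).\<close>

lemma wallis_product_eq:
  "(\<Prod>k=1..n. (4 * (real k)\<^sup>2) / (4 * (real k)\<^sup>2 - 1)) = 1 / ((2 * real n + 1) * (central_ratio n)\<^sup>2)"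
proof (induction n)
  case (Suc n)
  have fac: "4 * (real (Suc n))\<^sup>2 - 1 = (2 * real n + 1) * (2 * real n + 3)"
    by (simp add: power2_eq_square algebra_simps)
  have nz: "2 * real n + 1 \<noteq> 0" "2 * real n + 3 \<noteq> 0" "2 * real n + 2 \<noteq> 0" "central_ratio n \<noteq> 0"
    using central_ratio_pos[of n] by linarith+
  have "(\<Prod>k=1..Suc n. (4 * (real k)\<^sup>2) / (4 * (real k)\<^sup>2 - 1))
      = 1 / ((2 * real n + 1) * (central_ratio n)\<^sup>2)
        * ((2 * real n + 2)\<^sup>2 / ((2 * real n + 1) * (2 * real n + 3)))"
  proof -
    have sq: "4 * (real (Suc n))\<^sup>2 = (2 * real n + 2)\<^sup>2"
      by (simp add: power2_eq_square algebra_simps)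
    have "(\<Prod>k=1..Suc n. (4 * (real k)\<^sup>2) / (4 * (real k)\<^sup>2 - 1))
        = (\<Prod>k=1..n. (4 * (real k)\<^sup>2) / (4 * (real k)\<^sup>2 - 1))
          * ((4 * (real (Suc n))\<^sup>2) / (4 * (real (Suc n))\<^sup>2 - 1))"
      by (subst prod.nat_ivl_Suc') simp_all
    then show ?thesis
      by (simp only: Suc.IH fac) (simp only: sq)
  qed
  also have "\<dots> = 1 / ((2 * real n + 3)
      * (central_ratio n * (2 * real n + 1) / (2 * real n + 2))\<^sup>2)"
    using nz by (simp add: power_mult_distrib power_divide) (simp add: power2_eq_square mult_ac)
  also have "\<dots> = 1 / ((2 * real (Suc n) + 1) * (central_ratio (Suc n))\<^sup>2)"
    unfolding central_ratio_Suc by (simp add: algebra_simps)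
  finally show ?case .
qed simp

text \<open>The sequence is n/(2n+1) divided by the partial Wallis product, so its limit is (1/2) /
  (pi/2).\<close>

lemma mult_central_ratio_tendsto: "(\<lambda>n. real n * (central_ratio n)\<^sup>2) \<longlonglongrightarrow> 1 / pi"
proof -
  have A: "(\<lambda>n. 1 / ((2 * real n + 1) * (central_ratio n)\<^sup>2)) \<longlonglongrightarrow> pi / 2"
    using wallis unfolding wallis_product_eq .
  have B: "(\<lambda>n. real n / (2 * real n + 1)) \<longlonglongrightarrow> 1 / 2"
    by real_asymp
  have eq: "(real n / (2 * real n + 1)) / (1 / ((2 * real n + 1) * (central_ratio n)\<^sup>2))
      = real n * (central_ratio n)\<^sup>2" for n
  proof -
    have "2 * real n + 1 \<noteq> 0" by linarith
    then show ?thesis by simp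
  qed
  show ?thesis
    using tendsto_divide[OF B A] by (simp only: eq) simp
qed

text \<open>An increasing sequence stays below its limit, here 1/pi.\<close>

lemma central_ratio_le:
  assumes "1 \<le> n"
  shows "central_ratio n \<le> 1 / sqrt (pi * real n)"
proof (rule power2_le_imp_le)
  have "real n * (central_ratio n)\<^sup>2 \<le> 1 / pi"
    by (rule incseq_le[OF incseq_mult_central_ratio mult_central_ratio_tendsto])
  then show "(central_ratio n)\<^sup>2 \<le> (1 / sqrt (pi * real n))\<^sup>2"
    using assms by (simp add: power_divide field_simps)
qed simp

lemma inverse_central_ratio_le:
  assumes "1 \<le> n"
  shows "1 / central_ratio n \<le> 2 * sqrt (real n)"
proof (rule power2_le_imp_le)
  \<comment> \<open>The increasing sequence is bounded below by its value 1/4 at index 1, since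
    \<open>central_ratio 1\<close> is 1/2. This is the source of the factor 2.\<close>
  have "real 1 * (central_ratio 1)\<^sup>2 \<le> real n * (central_ratio n)\<^sup>2"
    using incseqD[OF incseq_mult_central_ratio assms] .
  then have "1 \<le> 4 * (real n * (central_ratio n)\<^sup>2)"
    by (simp add: central_ratio_def power2_eq_square)
  then show "(1 / central_ratio n)\<^sup>2 \<le> (2 * sqrt (real n))\<^sup>2"
    using central_ratio_pos[of n] by (simp add: power_divide power_mult_distrib divide_simps mult_ac)
qed simp

text \<open>At x = 0 both sides are 0, by the conventions for \<open>powr\<close> and
  division.\<close>

lemma powr_minus_three_halves:
  fixes x :: real
  assumes "0 \<le> x"
  shows "x powr (-3/2) = 1 / (x * sqrt x)"
proof -
  have "x powr (-3/2) = 1 / x powr (1 + 1/2)"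
    using powr_minus_divide[of x "3/2"] by simp
  then show ?thesis
    using assms unfolding powr_add by (simp add: powr_half_sqrt)
qed

subsection \<open>Bounds for the coefficients\<close>

lemma t_even_summand_bounds:
  assumes r: "1 \<le> r"
  shows "0 \<le> t_even_summand m 1 r"
    and "t_even_summand m 1 r \<le> T_const m / (4 * sqrt (2 * pi)) * real r powr (-3/2)"
proof -
  have eq: "t_even_summand m 1 r = central_ratio (2 * r) / real (4 * r + 1) * t_fin (2 * r) m"
    by (simp add: t_even_summand_def central_ratio_def power_mult)
  show "0 \<le> t_even_summand m 1 r"
    unfolding eq using central_ratio_pos[of "2 * r"] by (simp add: t_fin_nonneg)
  \<comment> \<open>Lowering 4r+1 to 4r leaves an exact multiple of r^(-3/2) and gives the constant
    4 sqrt(2 pi).\<close>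
  have "central_ratio (2 * r) / real (4 * r + 1) \<le> (1 / sqrt (pi * real (2 * r))) / (4 * real r)"
    using r by (intro frac_le central_ratio_le) auto
  then have "t_even_summand m 1 r \<le> (1 / sqrt (pi * real (2 * r))) / (4 * real r) * T_const m"
    unfolding eq by (intro mult_mono t_fin_le t_fin_nonneg) auto
  also have "\<dots> = T_const m / (4 * sqrt (2 * pi)) * real r powr (-3/2)"
    by (simp only: powr_minus_three_halves of_nat_0_le_iff) (simp add: real_sqrt_mult mult_ac)
  finally show "t_even_summand m 1 r \<le> T_const m / (4 * sqrt (2 * pi)) * real r powr (-3/2)" .
qed

lemma t_odd_summand_bounds:
  assumes r: "1 \<le> r"
  shows "0 \<le> t_odd_summand m 1 r"
    and "t_odd_summand m 1 r \<le> T_const m / sqrt pi * real r powr (-3/2)"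
proof -
  have "(2::real) ^ (4 * r + 2) = 4 ^ (2 * r + 1)"
    using power_mult[of "2::real" 2 "2 * r + 1"] by simp
  then have eq: "t_odd_summand m 1 r = central_ratio (2 * r + 1) / real (4 * r + 3) * t_fin (2 * r + 1) m"
    by (simp add: t_odd_summand_def central_ratio_def)
  show "0 \<le> t_odd_summand m 1 r"
    unfolding eq using central_ratio_pos[of "2 * r + 1"] by (simp add: t_fin_nonneg)
  have "central_ratio (2 * r + 1) \<le> 1 / sqrt (pi * real (2 * r + 1))"
    by (rule central_ratio_le) simp
  \<comment> \<open>A deliberately coarse estimate: 2r+1 and then 4r+3 are both lowered to r, which
    produces the constant 1/sqrt(pi).\<close>
  also have "\<dots> \<le> 1 / sqrt (pi * real r)"
    using r by (intro divide_left_mono) auto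
  finally have "central_ratio (2 * r + 1) / real (4 * r + 3) \<le> (1 / sqrt (pi * real r)) / real r"
    using r by (intro frac_le) auto
  then have "t_odd_summand m 1 r \<le> (1 / sqrt (pi * real r)) / real r * T_const m"
    unfolding eq by (intro mult_mono t_fin_le t_fin_nonneg) auto
  also have "\<dots> = T_const m / sqrt pi * real r powr (-3/2)"
    by (simp only: powr_minus_three_halves of_nat_0_le_iff) (simp add: real_sqrt_mult mult_ac)
  finally show "t_odd_summand m 1 r \<le> T_const m / sqrt pi * real r powr (-3/2)" .
qed

lemma zeta_even_summand_bounds:
  assumes r: "1 \<le> r"
  shows "0 \<le> zeta_even_summand m 1 r"
    and "zeta_even_summand m 1 r \<le> 2 * sqrt 2 * Z_const (m - 1) * real r powr (-3/2)"
proof -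
  have eq: "zeta_even_summand m 1 r
      = (1 / central_ratio (2 * r)) / (real r)\<^sup>2 * zeta_fin (2 * r - 1) (m - 1)"
    by (simp add: zeta_even_summand_def central_ratio_def power_mult)
  show "0 \<le> zeta_even_summand m 1 r"
    unfolding eq using central_ratio_pos[of "2 * r"] by (simp add: zeta_fin_nonneg)
  have "(1 / central_ratio (2 * r)) / (real r)\<^sup>2 \<le> 2 * sqrt (real (2 * r)) / (real r)\<^sup>2"
    using r by (intro divide_right_mono inverse_central_ratio_le) auto
  then have "zeta_even_summand m 1 r \<le> 2 * sqrt (real (2 * r)) / (real r)\<^sup>2 * Z_const (m - 1)"
    unfolding eq by (intro mult_mono zeta_fin_le zeta_fin_nonneg) auto
  also have "\<dots> = 2 * Z_const (m - 1) * (sqrt (real (2 * r)) / (real r)\<^sup>2)"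
    by simp
  also have "sqrt (real (2 * r)) / (real r)\<^sup>2 = sqrt 2 * real r powr (-3/2)"
    using r by (simp only: powr_minus_three_halves of_nat_0_le_iff)
      (simp add: real_sqrt_mult power2_eq_square divide_simps)
  also have "2 * Z_const (m - 1) * (sqrt 2 * real r powr (-3/2))
      = 2 * sqrt 2 * Z_const (m - 1) * real r powr (-3/2)"
    by (simp only: mult_ac)
  finally show "zeta_even_summand m 1 r \<le> 2 * sqrt 2 * Z_const (m - 1) * real r powr (-3/2)" .
qed

lemma zeta_odd_summand_bounds:
  assumes r: "1 \<le> r"
  shows "0 \<le> zeta_odd_summand m 1 r"
    and "zeta_odd_summand m 1 r \<le> 2 * Z_const (m - 1) * real r powr (-3/2)"
proof -
  define n where "n = 2 * r + 1"
  have eq: "zeta_odd_summand m 1 r = (1 / central_ratio n) / (real n)\<^sup>2 * zeta_fin (2 * r) (m - 1)"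
    by (simp add: zeta_odd_summand_def central_ratio_def n_def)
  show "0 \<le> zeta_odd_summand m 1 r"
    unfolding eq using central_ratio_pos[of n] by (simp add: zeta_fin_nonneg)
  have "(1 / central_ratio n) / (real n)\<^sup>2 \<le> 2 * sqrt (real n) / (real n)\<^sup>2"
    by (intro divide_right_mono inverse_central_ratio_le) (auto simp: n_def)
  also have "\<dots> = 2 * real n powr (-3/2)"
    by (simp only: powr_minus_three_halves of_nat_0_le_iff) (simp add: power2_eq_square divide_simps)
  \<comment> \<open>The bound is exact in n = 2r+1 up to here; replacing n by the smaller r enlarges
    a negative power.\<close>
  also have "\<dots> \<le> 2 * real r powr (-3/2)"
    using r by (intro mult_left_mono powr_mono2') (auto simp: n_def)
  finally have "zeta_odd_summand m 1 r \<le> 2 * real r powr (-3/2) * Z_const (m - 1)"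
    unfolding eq by (intro mult_mono zeta_fin_le zeta_fin_nonneg) auto
  then show "zeta_odd_summand m 1 r \<le> 2 * Z_const (m - 1) * real r powr (-3/2)"
    by (simp add: mult_ac)
qed

subsection \<open>Tails\<close>

text \<open>\<open>h r\<close> serves as an upper estimate for the tail beyond \<open>r\<close>. The
  sum over (N, N+k] is at most \<open>h N - h (N + k)\<close>, hence at most
  \<open>h N\<close>.\<close>

lemma infsum_tail_telescope:
  fixes f h :: "nat \<Rightarrow> real"
  assumes f: "\<And>r. N < r \<Longrightarrow> 0 \<le> f r"
    and step: "\<And>r. N \<le> r \<Longrightarrow> f (Suc r) \<le> h r - h (Suc r)"
    and h: "\<And>r. N \<le> r \<Longrightarrow> 0 \<le> h r"
  shows "f summable_on {N<..}" and "\<bar>\<Sum>\<^sub>\<infinity>r\<in>{N<..}. f r\<bar> \<le> h N"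
proof -
  have part: "sum f {N<..N + k} \<le> h N - h (N + k)" for k
  proof (induction k)
    case (Suc k)
    have "{N<..N + Suc k} = insert (Suc (N + k)) {N<..N + k}" by auto
    then have "sum f {N<..N + Suc k} = f (Suc (N + k)) + sum f {N<..N + k}" by simp
    then show ?case using Suc step[of "N + k"] by simp
  qed simp
  \<comment> \<open>\<open>summable_on\<close> is unconditional, so every finite subset must be
    bounded; each one lies in some interval of the previous step.\<close>
  have fin: "sum f F \<le> h N" if F: "finite F" "F \<subseteq> {N<..}" for F
  proof -
    obtain M where "\<forall>r\<in>F. r \<le> M"
      using F(1) finite_nat_set_iff_bounded_le by blast
    then have "F \<subseteq> {N<..N + M}" using F(2) by fastforce
    then have "sum f F \<le> sum f {N<..N + M}"
      using f by (intro sum_mono2) auto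
    also have "\<dots> \<le> h N" using part[of M] h[of "N + M"] by simp
    finally show ?thesis .
  qed
  show sm: "f summable_on {N<..}"
    using f fin by (intro nonneg_bdd_above_summable_on bdd_aboveI2[where M = "h N"]) auto
  have "(\<Sum>\<^sub>\<infinity>r\<in>{N<..}. f r) \<le> h N"
    by (rule infsum_le_finite_sums[OF sm]) (use fin in auto)
  moreover have "0 \<le> (\<Sum>\<^sub>\<infinity>r\<in>{N<..}. f r)"
    by (rule infsum_nonneg) (use f in auto)
  ultimately show "\<bar>\<Sum>\<^sub>\<infinity>r\<in>{N<..}. f r\<bar> \<le> h N" by simp
qed

text \<open>The right side is the integral of t^(-3/2) over [x, x+1], and the integrand is smallest
  at x+1. The proof is algebraic: with \<open>a\<close> and \<open>b\<close> the two square roots,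
  b^2 - a^2 = 1 gives 1/a - 1/b = 1/(ab(a+b)), and ab(a+b) \<le> 2b^3.\<close>

lemma powr_minus_three_halves_le_diff:
  fixes x :: real
  assumes "0 < x"
  shows "(x + 1) powr (-3/2) \<le> 2 * x powr (-1/2) - 2 * (x + 1) powr (-1/2)"
proof -
  define a b where "a = sqrt x" and "b = sqrt (x + 1)"
  have ab: "0 < a" "a \<le> b" "b\<^sup>2 = a\<^sup>2 + 1" "x + 1 = b\<^sup>2"
    using assms by (auto simp: a_def b_def)
  have half: "y powr (-1/2) = 1 / sqrt y" if "0 < y" for y :: real
    using that powr_minus_divide[of y "1/2"] by (simp add: powr_half_sqrt)
  have "a * b * (a + b) \<le> 2 * b ^ 3"
  proof -
    have "a * b * (a + b) \<le> b * b * (b + b)"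
      using ab by (intro mult_mono) auto
    then show ?thesis by (simp add: power3_eq_cube)
  qed
  then have "2 / (2 * b ^ 3) \<le> 2 / (a * b * (a + b))"
    using ab(1,2) by (intro divide_left_mono) auto
  then have "1 / b ^ 3 \<le> 2 / (a * b * (a + b))" by simp
  also have "\<dots> = 2 * ((b\<^sup>2 - a\<^sup>2) / (a * b * (a + b)))"
    by (simp add: ab(3))
  also have "\<dots> = 2 * (1 / a) - 2 * (1 / b)"
  proof -
    have "(b\<^sup>2 - a\<^sup>2) / (a * b * (a + b)) = (b - a) / (a * b)"
      using ab(1,2) by (simp add: power2_eq_square square_diff_square_factored divide_simps)
    also have "\<dots> = 1 / a - 1 / b"
      using ab(1,2) by (simp add: field_simps)
    finally show ?thesis by simp
  qed
  finally have "1 / b ^ 3 \<le> 2 * (1 / a) - 2 * (1 / b)" .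
  moreover have "(x + 1) powr (-3/2) = 1 / b ^ 3"
    using assms ab(1,2,4) powr_minus_three_halves[of "x + 1"]
    by (simp add: power3_eq_cube power2_eq_square flip: b_def)
  ultimately show ?thesis
    using half[of x] half[of "x + 1"] assms by (simp add: a_def b_def)
qed

text \<open>What the four families share. The bounds start at r = 1 because index 0 lies in no tail,
  and there \<open>0 powr (-3/2)\<close> is 0, which would be too small for a positive constant
  term.\<close>

locale powr_bounded_summand =
  fixes s :: "real \<Rightarrow> nat \<Rightarrow> real" and K :: real
  assumes scale: "\<And>u r. s u r = s 1 r * u ^ r"
    and nonneg: "\<And>r. 1 \<le> r \<Longrightarrow> 0 \<le> s 1 r"
    and bound: "\<And>r. 1 \<le> r \<Longrightarrow> s 1 r \<le> K * real r powr (-3/2)"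
begin

lemma bound_const_nonneg: "0 \<le> K"
  using nonneg[of 1] bound[of 1] by simp

text \<open>On the tail the factor r^(-3/2) is at most (N+1)^(-3/2); what remains is a geometric
  series.\<close>

lemma geometric_tail:
  assumes u: "0 < u" "u < 1"
  shows "s u summable_on {N<..} \<and>
    \<bar>\<Sum>\<^sub>\<infinity>r\<in>{N<..}. s u r\<bar> \<le> K * (u ^ (N + 1) / ((real N + 1) powr (3/2) * (1 - u)))"
proof -
  define c where "c = K * (real N + 1) powr (-3/2)"
  \<comment> \<open>This is \<open>c\<close> times the geometric tail of u^k over k > r, so
    consecutive values differ by exactly c u^(r+1).\<close>
  define h where "h r = c * u ^ Suc r / (1 - u)" for r
  have c: "0 \<le> c" by (simp add: c_def bound_const_nonneg)
  have "s u (Suc r) \<le> h r - h (Suc r)" if "N \<le> r" for r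
  proof -
    have "s 1 (Suc r) \<le> K * real (Suc r) powr (-3/2)" by (rule bound) simp
    also have "\<dots> \<le> c"
      unfolding c_def using that by (intro mult_left_mono powr_mono2' bound_const_nonneg) auto
    finally have "s u (Suc r) \<le> c * u ^ Suc r"
      using u by (subst scale) (intro mult_right_mono, auto)
    also have "\<dots> = h r - h (Suc r)"
    proof -
      have "h r - h (Suc r) = c * u ^ Suc r * (1 - u) / (1 - u)"
        unfolding h_def diff_divide_distrib[symmetric] by (simp add: algebra_simps)
      then show ?thesis using u by simp
    qed
    finally show ?thesis .
  qed
  moreover have "0 \<le> s u r" if "N < r" for r
    using that u nonneg[of r] by (subst scale) auto
  moreover have "0 \<le> h r" for r using c u by (simp add: h_def)
  moreover have "h N = K * (u ^ (N + 1) / ((real N + 1) powr (3/2) * (1 - u)))"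
    using powr_minus_divide[of "real N + 1" "3/2"] by (simp add: h_def c_def)
  ultimately show ?thesis
    using infsum_tail_telescope[of N "s u" h] by metis
qed

lemma endpoint_step:
  assumes "1 \<le> r"
  shows "s 1 (Suc r) \<le> 2 * K * real r powr (-1/2) - 2 * K * real (Suc r) powr (-1/2)"
proof -
  have "s 1 (Suc r) \<le> K * (real r + 1) powr (-3/2)"
    using bound[of "Suc r"] by (simp add: add.commute)
  also have "\<dots> \<le> K * (2 * real r powr (-1/2) - 2 * (real r + 1) powr (-1/2))"
    using assms by (intro mult_left_mono powr_minus_three_halves_le_diff bound_const_nonneg) auto
  finally show ?thesis by (simp add: algebra_simps)
qed

lemma endpoint_tail_Suc:
  "s 1 summable_on {N<..}" (is ?summable)
  "\<bar>\<Sum>\<^sub>\<infinity>r\<in>{N<..}. s 1 r\<bar> \<le> 3 * K * (real N + 1) powr (-1/2)" (is ?le)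
proof -
  \<comment> \<open>The value 2K r^(-1/2) cannot start the telescoping at N = 0, where
    \<open>powr\<close> returns 0. The first term is therefore estimated separately by K
    (N+1)^(-1/2), and the rest by 2K (N+1)^(-1/2), which adds up to 3K.\<close>
  define h where
    "h r = (if r = N then 3 * K * (real N + 1) powr (-1/2) else 2 * K * real r powr (-1/2))" for r
  have "s 1 (Suc r) \<le> h r - h (Suc r)" if "N \<le> r" for r
  proof (cases "r = N")
    case True
    have "s 1 (Suc N) \<le> K * (real N + 1) powr (-3/2)"
      using bound[of "Suc N"] by (simp add: add.commute)
    also have "\<dots> \<le> K * (real N + 1) powr (-1/2)"
      by (intro mult_left_mono powr_mono bound_const_nonneg) auto
    finally show ?thesis using True by (simp add: h_def add.commute)
  next
    case False
    then show ?thesis using endpoint_step[of r] that by (simp add: h_def)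
  qed
  moreover have "0 \<le> h r" for r by (simp add: h_def bound_const_nonneg)
  ultimately show ?summable ?le
    using infsum_tail_telescope[of N "s 1" h] nonneg by (auto simp: h_def)
qed

text \<open>For N \<ge> 1 the telescoping can start at N itself, with no separate first term, so the
  constant is 2K.\<close>

lemma endpoint_tail:
  assumes "1 \<le> N"
  shows "\<bar>\<Sum>\<^sub>\<infinity>r\<in>{N<..}. s 1 r\<bar> \<le> 2 * K * real N powr (-1/2)"
  using infsum_tail_telescope(2)[of N "s 1" "\<lambda>r. 2 * K * real r powr (-1/2)"]
    endpoint_step nonneg assms bound_const_nonneg by simp

lemma endpoint_tails:
  "s 1 summable_on {0<..} \<and>
    (\<lambda>N::nat. \<Sum>\<^sub>\<infinity>r\<in>{N<..}. s 1 r) \<in> O(\<lambda>N. (real N + 1) powr (-1/2)) \<and>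
    (\<forall>N::nat. \<bar>\<Sum>\<^sub>\<infinity>r\<in>{N<..}. s 1 r\<bar> \<le> 3 * K * (real N + 1) powr (-1/2)) \<and>
    (\<forall>N::nat. N \<ge> 1 \<longrightarrow> \<bar>\<Sum>\<^sub>\<infinity>r\<in>{N<..}. s 1 r\<bar> \<le> 2 * K * real N powr (-1/2))"
proof (intro conjI allI impI)
  show "(\<lambda>N::nat. \<Sum>\<^sub>\<infinity>r\<in>{N<..}. s 1 r) \<in> O(\<lambda>N. (real N + 1) powr (-1/2))"
    using endpoint_tail_Suc(2) by (intro bigoI[of _ "3 * K"]) simp
qed (use endpoint_tail_Suc endpoint_tail in auto)

end

section \<open>The four families as instances of the general tail estimates\<close>

lemma summand_scale:
  "t_even_summand m u r = t_even_summand m 1 r * u ^ r"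
  "t_odd_summand m u r = t_odd_summand m 1 r * u ^ r"
  "zeta_even_summand m u r = zeta_even_summand m 1 r * u ^ r"
  "zeta_odd_summand m u r = zeta_odd_summand m 1 r * u ^ r"
  by (simp_all add: t_even_summand_def t_odd_summand_def zeta_even_summand_def zeta_odd_summand_def)

interpretation t_even: powr_bounded_summand "t_even_summand m" "T_const m / (4 * sqrt (2 * pi))" for m
  by unfold_locales (fact summand_scale t_even_summand_bounds)+

interpretation t_odd: powr_bounded_summand "t_odd_summand m" "T_const m / sqrt pi" for m
  by unfold_locales (fact summand_scale t_odd_summand_bounds)+

interpretation zeta_even: powr_bounded_summand "zeta_even_summand m" "2 * sqrt 2 * Z_const (m - 1)" for m
  by unfold_locales (fact summand_scale zeta_even_summand_bounds)+

interpretation zeta_odd: powr_bounded_summand "zeta_odd_summand m" "2 * Z_const (m - 1)" for m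
  by unfold_locales (fact summand_scale zeta_odd_summand_bounds)+

theorem theorem7p2:
  shows "
    (\<forall>(u::real) (N::nat) (m::nat). 0 < u \<and> u < 1 \<longrightarrow>
        t_even_summand m u summable_on {N<..} \<and>
        \<bar>\<Sum>\<^sub>\<infinity>r\<in>{N<..}. t_even_summand m u r\<bar>
          \<le> T_const m / (4 * sqrt (2 * pi)) * (u ^ (N + 1) / ((real N + 1) powr (3/2) * (1 - u)))) \<and>
    (\<forall>(u::real) (N::nat) (m::nat). 0 < u \<and> u < 1 \<longrightarrow>
        t_odd_summand m u summable_on {N<..} \<and>
        \<bar>\<Sum>\<^sub>\<infinity>r\<in>{N<..}. t_odd_summand m u r\<bar>
          \<le> T_const m / sqrt pi * (u ^ (N + 1) / ((real N + 1) powr (3/2) * (1 - u)))) \<and>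
    (\<forall>(u::real) (N::nat) (m::nat). 0 < u \<and> u < 1 \<longrightarrow> m \<ge> 1 \<longrightarrow>
        zeta_even_summand m u summable_on {N<..} \<and>
        \<bar>\<Sum>\<^sub>\<infinity>r\<in>{N<..}. zeta_even_summand m u r\<bar>
          \<le> 2 * sqrt 2 * Z_const (m - 1) * (u ^ (N + 1) / ((real N + 1) powr (3/2) * (1 - u)))) \<and>
    (\<forall>(u::real) (N::nat) (m::nat). 0 < u \<and> u < 1 \<longrightarrow> m \<ge> 1 \<longrightarrow>
        zeta_odd_summand m u summable_on {N<..} \<and>
        \<bar>\<Sum>\<^sub>\<infinity>r\<in>{N<..}. zeta_odd_summand m u r\<bar>
          \<le> 2 * Z_const (m - 1) * (u ^ (N + 1) / ((real N + 1) powr (3/2) * (1 - u)))) \<and>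
    (\<forall>m::nat.
        t_even_summand m 1 summable_on {0<..} \<and>
        (\<lambda>N::nat. \<Sum>\<^sub>\<infinity>r\<in>{N<..}. t_even_summand m 1 r) \<in> O(\<lambda>N. (real N + 1) powr (-1/2)) \<and>
        (\<forall>N::nat. \<bar>\<Sum>\<^sub>\<infinity>r\<in>{N<..}. t_even_summand m 1 r\<bar>
          \<le> 3 * (T_const m / (4 * sqrt (2 * pi))) * (real N + 1) powr (-1/2)) \<and>
        (\<forall>N::nat. N \<ge> 1 \<longrightarrow> \<bar>\<Sum>\<^sub>\<infinity>r\<in>{N<..}. t_even_summand m 1 r\<bar>
          \<le> 2 * (T_const m / (4 * sqrt (2 * pi))) * real N powr (-1/2))) \<and>
    (\<forall>m::nat.
        t_odd_summand m 1 summable_on {0<..} \<and>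
        (\<lambda>N::nat. \<Sum>\<^sub>\<infinity>r\<in>{N<..}. t_odd_summand m 1 r) \<in> O(\<lambda>N. (real N + 1) powr (-1/2)) \<and>
        (\<forall>N::nat. \<bar>\<Sum>\<^sub>\<infinity>r\<in>{N<..}. t_odd_summand m 1 r\<bar>
          \<le> 3 * (T_const m / sqrt pi) * (real N + 1) powr (-1/2)) \<and>
        (\<forall>N::nat. N \<ge> 1 \<longrightarrow> \<bar>\<Sum>\<^sub>\<infinity>r\<in>{N<..}. t_odd_summand m 1 r\<bar>
          \<le> 2 * (T_const m / sqrt pi) * real N powr (-1/2))) \<and>
    (\<forall>m::nat. m \<ge> 1 \<longrightarrow>
        zeta_even_summand m 1 summable_on {0<..} \<and>
        (\<lambda>N::nat. \<Sum>\<^sub>\<infinity>r\<in>{N<..}. zeta_even_summand m 1 r) \<in> O(\<lambda>N. (real N + 1) powr (-1/2)) \<and>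
        (\<forall>N::nat. \<bar>\<Sum>\<^sub>\<infinity>r\<in>{N<..}. zeta_even_summand m 1 r\<bar>
          \<le> 3 * (2 * sqrt 2 * Z_const (m - 1)) * (real N + 1) powr (-1/2)) \<and>
        (\<forall>N::nat. N \<ge> 1 \<longrightarrow> \<bar>\<Sum>\<^sub>\<infinity>r\<in>{N<..}. zeta_even_summand m 1 r\<bar>
          \<le> 2 * (2 * sqrt 2 * Z_const (m - 1)) * real N powr (-1/2))) \<and>
    (\<forall>m::nat. m \<ge> 1 \<longrightarrow>
        zeta_odd_summand m 1 summable_on {0<..} \<and>
        (\<lambda>N::nat. \<Sum>\<^sub>\<infinity>r\<in>{N<..}. zeta_odd_summand m 1 r) \<in> O(\<lambda>N. (real N + 1) powr (-1/2)) \<and>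
        (\<forall>N::nat. \<bar>\<Sum>\<^sub>\<infinity>r\<in>{N<..}. zeta_odd_summand m 1 r\<bar>
          \<le> 3 * (2 * Z_const (m - 1)) * (real N + 1) powr (-1/2)) \<and>
        (\<forall>N::nat. N \<ge> 1 \<longrightarrow> \<bar>\<Sum>\<^sub>\<infinity>r\<in>{N<..}. zeta_odd_summand m 1 r\<bar>
          \<le> 2 * (2 * Z_const (m - 1)) * real N powr (-1/2)))"
  \<comment> \<open>Each of the eight conjuncts is the geometric or the endpoint estimate for one
    family.\<close>
  by (intro conjI; intro allI impI; (elim conjE)?;
      rule t_even.geometric_tail t_odd.geometric_tail zeta_even.geometric_tail zeta_odd.geometric_tail
        t_even.endpoint_tails t_odd.endpoint_tails zeta_even.endpoint_tails zeta_odd.endpoint_tails;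
      assumption)

end
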